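(* The following assertion is false: if $(z_k)_{k \ge 1}$ and $(a_k)_{k \ge 1}$ are sequences of complex numbers such that $\lim_{k\to\infty} z_k = \infty$, $\sum_{z_k \neq 0} \left| \frac{a_k}{z_k} \right| < \infty$, and $a_k \overline{z_k} > 0$ (that is, $a_k\overline{z_k}$ is real and positive) for each $k$, then the function $$ f(z) = \sum_{k=1}^\infty \frac{a_k}{z - z_k} $$ has infinitely many zeros in $\mathbb{C}$.
   Context: Under the stated hypotheses $f$ is a meromorphic function in $\mathbb{C}$; a zero of $f$ is a point at which the meromorphic function takes the value $0$, and poles are not zeros. *)

theory Defs
  imports "HOL-Complex_Analysis.Complex_Analysis"
begin

(* The index set of the sequences is shifted from {1, 2, ...} to {0, 1, ...}.  At w = z k the
   summand a k / (w - z k) is 0 by the convention x / 0 = 0, so the raw value of this function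
   at a pole carries no meaning. *)
definition simple_fraction_series ::
    "(nat \<Rightarrow> complex) \<Rightarrow> (nat \<Rightarrow> complex) \<Rightarrow> complex \<Rightarrow> complex" where
  "simple_fraction_series a z = (\<lambda>w. \<Sum>k. a k / (w - z k))"

(* Intended for f meromorphic_on UNIV.  The value of the meromorphic function at w is that of
   remove_sings f, which agrees with f wherever f is analytic, does not depend on junk values of
   f at isolated points, and is 0 by convention at poles; hence poles are excluded explicitly. *)
definition meromorphic_zeros :: "(complex \<Rightarrow> complex) \<Rightarrow> complex set" where
  "meromorphic_zeros f = {w. \<not> is_pole f w \<and> remove_sings f w = 0}"

end

theory Submission
  imports Defs
begin

text \<open>
  Idea: take \<open>z\<^sub>k = 64\<^sup>k e\<^bsup>i\<theta>\<^sub>k\<^esup>\<close> and \<open>f = -1/G\<close> with \<open>G(w) = \<Prod>\<^sub>j (1 - w/z\<^sub>j)\<close>, so that \<open>f\<close> has no zeros.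
  The Lagrange partial fraction expansions of the finite products converge to
  \<open>f(w) = \<Sum>\<^sub>k b\<^sub>k z\<^sub>k / (w - z\<^sub>k)\<close> with \<open>1/b\<^sub>k = \<Prod>\<^bsub>j\<noteq>k\<^esub> (1 - z\<^sub>k/z\<^sub>j)\<close>, and it remains to
  choose the angles such that every \<open>b\<^sub>k\<close> is positive.  For \<open>j < k\<close> the factor \<open>1 - z\<^sub>k/z\<^sub>j\<close> is
  \<open>-z\<^sub>k/z\<^sub>j\<close> up to a small relative error, and for \<open>j > k\<close> it is close to 1; hence for \<open>k > 0\<close> the
  condition on the argument is a small perturbation of a triangular linear system for the angles,
  which is solved by the contraction principle.  Positivity of \<open>b\<^sub>0\<close> follows from the others
  and \<open>\<Sum>\<^sub>k b\<^sub>k = -f(0) = 1\<close>.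
\<close>

section \<open>Lagrange interpolation and finite partial fractions\<close>

text \<open>The Lagrange basis polynomials minus 1 give a polynomial of degree at most
  \<open>N - 1\<close> that vanishes at \<open>N\<close> distinct nodes, hence the zero
  polynomial.\<close>

lemma lagrange_basis_sum:
  fixes z :: "nat \<Rightarrow> 'a :: field"
  assumes inj: "inj_on z {..<N}" and N: "N > 0"
  shows "(\<Sum>k<N. \<Prod>j\<in>{..<N} - {k}. (w - z j) / (z k - z j)) = 1"
proof -
  define L where
    "L k = smult (inverse (\<Prod>j\<in>{..<N} - {k}. z k - z j)) (\<Prod>j\<in>{..<N} - {k}. [:- z j, 1:])" for k
  have poly_L: "poly (L k) x = (\<Prod>j\<in>{..<N} - {k}. (x - z j) / (z k - z j))" for k x
    by (simp add: L_def poly_prod prod_dividef field_simps)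
  define p where "p = (\<Sum>k<N. L k) - 1"
  have "degree (L k) \<le> N - 1" if "k < N" for k
  proof -
    have "degree (\<Prod>j\<in>{..<N} - {k}. [:- z j, 1:]) \<le> (\<Sum>j\<in>{..<N} - {k}. degree [:- z j, 1:])"
      by (rule order_trans[OF degree_prod_sum_le]) simp_all
    also have "\<dots> = N - 1" using that by simp
    finally show ?thesis unfolding L_def by (meson degree_smult_le le_trans)
  qed
  then have deg: "degree p \<le> N - 1"
    unfolding p_def by (intro degree_diff_le degree_sum_le) auto
  have root: "poly p (z i) = 0" if i: "i < N" for i
  proof -
    have "poly (L k) (z i) = (if k = i then 1 else 0)" if k: "k < N" for k
    proof (cases "k = i")
      case True
      then show ?thesis unfolding poly_L using inj i
        by (auto intro!: prod.neutral simp: inj_on_eq_iff[OF inj])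
    next
      case False
      then have "i \<in> {..<N} - {k}" using i by auto
      then show ?thesis unfolding poly_L using False by (auto simp: prod_zero_iff)
    qed
    then have "(\<Sum>k<N. poly (L k) (z i)) = (\<Sum>k<N. if k = i then 1 else 0)"
      by (intro sum.cong) auto
    then show ?thesis using i by (simp add: p_def poly_sum)
  qed
  have "p = 0"
  proof (rule ccontr)
    assume p: "p \<noteq> 0"
    have "N = card (z ` {..<N})" using inj by (simp add: card_image)
    also have "\<dots> \<le> card {x. poly p x = 0}"
      using root p by (intro card_mono poly_roots_finite) auto
    also have "\<dots> \<le> degree p" by (rule card_poly_roots_bound[OF p])
    finally show False using deg N by linarith
  qed
  then have "poly p w = 0" by simp
  then have "(\<Sum>k<N. poly (L k) w) = 1" by (simp add: p_def poly_sum)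
  then show ?thesis by (simp add: poly_L)
qed

text \<open>Each summand on the right is the \<open>k\<close>-th Lagrange basis polynomial at
  \<open>w\<close> divided by the full product, so this is the previous identity divided by that
  product.\<close>

lemma partial_fractions_inverse_prod:
  fixes z :: "nat \<Rightarrow> 'a :: field"
  assumes inj: "inj_on z {..<N}" and N: "N > 0"
    and nz: "\<And>j. j < N \<Longrightarrow> z j \<noteq> 0" and w: "\<And>j. j < N \<Longrightarrow> w \<noteq> z j"
  shows "inverse (\<Prod>j<N. 1 - w / z j) =
    (\<Sum>k<N. inverse (\<Prod>j\<in>{..<N} - {k}. 1 - z k / z j) / (1 - w / z k))"
proof -
  define G where "G = (\<Prod>j<N. 1 - w / z j)"
  have G: "G \<noteq> 0" using nz w by (auto simp: G_def)
  have "inverse (\<Prod>j\<in>{..<N} - {k}. 1 - z k / z j) / (1 - w / z k) =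
      inverse G * (\<Prod>j\<in>{..<N} - {k}. (w - z j) / (z k - z j))" if k: "k < N" for k
  proof -
    have "G = (1 - w / z k) * (\<Prod>j\<in>{..<N} - {k}. 1 - w / z j)"
      unfolding G_def using k by (intro prod.remove) auto
    moreover have "(\<Prod>j\<in>{..<N} - {k}. (w - z j) / (z k - z j)) =
        (\<Prod>j\<in>{..<N} - {k}. (1 - w / z j) / (1 - z k / z j))"
    proof (intro prod.cong refl)
      fix j assume "j \<in> {..<N} - {k}"
      then have "z j \<noteq> 0" "z k \<noteq> z j" using nz inj k by (auto simp: inj_on_def)
      then show "(w - z j) / (z k - z j) = (1 - w / z j) / (1 - z k / z j)"
        by (simp add: field_simps)
    qed
    moreover have "1 - w / z k \<noteq> 0" "(\<Prod>j\<in>{..<N} - {k}. 1 - w / z j) \<noteq> 0"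
      using nz w k by auto
    ultimately show ?thesis by (simp add: prod_dividef inverse_eq_divide)
  qed
  then have "(\<Sum>k<N. inverse (\<Prod>j\<in>{..<N} - {k}. 1 - z k / z j) / (1 - w / z k)) =
      inverse G * (\<Sum>k<N. \<Prod>j\<in>{..<N} - {k}. (w - z j) / (z k - z j))"
    by (simp add: sum_distrib_left)
  then show ?thesis by (simp add: lagrange_basis_sum[OF inj N] G_def)
qed

section \<open>Lipschitz bounds and two-sided geometric sums\<close>

text \<open>Mean value inequality on the disc of radius 1/2, where the derivative of
  \<open>Ln (1 - w)\<close> has modulus at most 2.\<close>

lemma norm_Ln_one_minus_diff_le:
  fixes u v :: complex
  assumes "norm u \<le> 1/2" "norm v \<le> 1/2"
  shows "norm (Ln (1 - u) - Ln (1 - v)) \<le> 2 * norm (u - v)"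
proof (rule field_differentiable_bound[where S = "cball 0 (1/2)" and f' = "\<lambda>w. - inverse (1 - w)"])
  show "convex (cball 0 (1/2) :: complex set)" by (rule convex_cball)
  fix w :: complex assume "w \<in> cball 0 (1/2)"
  then have w: "norm w \<le> 1/2" by simp
  have "1 - w \<notin> \<real>\<^sub>\<le>\<^sub>0"
  proof
    assume "1 - w \<in> \<real>\<^sub>\<le>\<^sub>0"
    then have "Re w \<ge> 1" by (simp add: complex_nonpos_Reals_iff)
    then show False using w complex_Re_le_cmod[of w] by linarith
  qed
  then show "((\<lambda>w. Ln (1 - w)) has_field_derivative - inverse (1 - w)) (at w within cball 0 (1/2))"
    by (auto intro!: derivative_eq_intros simp: field_simps)
  have "norm (1 - w) \<ge> 1/2" using w norm_triangle_ineq2[of 1 w] by simp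
  then show "norm (- inverse (1 - w)) \<le> 2"
    by (simp add: norm_divide norm_inverse inverse_eq_divide divide_simps)
qed (use assms in auto)

lemma norm_cis_diff_le: "norm (cis s - cis t) \<le> \<bar>s - t\<bar>"
proof -
  have "norm (exp (\<i> * of_real s) - exp (\<i> * of_real t)) \<le> 1 * norm (complex_of_real s - of_real t)"
  proof (rule field_differentiable_bound[where S = \<real> and f' = "\<lambda>w. \<i> * exp (\<i> * w)"])
    show "((\<lambda>w. exp (\<i> * w)) has_field_derivative \<i> * exp (\<i> * w)) (at w within \<real>)" for w
      by (auto intro!: derivative_eq_intros)
  qed (auto simp: norm_mult convex_Reals elim!: Reals_cases)
  then show ?thesis by (simp add: cis_conv_exp flip: of_real_diff)
qed

text \<open>With truncated subtraction the exponent is the distance of \<open>j\<close> and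
  \<open>k\<close>. The diagonal value 0 lets sums and products over all \<open>j\<close> skip
  \<open>j = k\<close> silently.\<close>

definition distance_power :: "real \<Rightarrow> nat \<Rightarrow> nat \<Rightarrow> real" where
  "distance_power x k j = (if j = k then 0 else x ^ ((k - j) + (j - k)))"

lemma distance_power_nonneg: "0 \<le> x \<Longrightarrow> 0 \<le> distance_power x k j"
  by (simp add: distance_power_def)

lemma distance_power_le: "0 \<le> x \<Longrightarrow> x \<le> 1 \<Longrightarrow> distance_power x k j \<le> x"
  using power_decreasing[of 1 "(k - j) + (j - k)" x] by (auto simp: distance_power_def)

lemma distance_power_sum:
  fixes x :: real
  assumes x: "0 \<le> x" "x < 1"
  shows "summable (distance_power x k)" "suminf (distance_power x k) \<le> 2 * x / (1 - x)"
proof -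
  define g where "g j = (if j < k then x ^ (k - j) else 0)" for j
  define h where "h j = (if j \<le> k then 0 else x ^ (j - k))" for j
  have fgh: "distance_power x k = (\<lambda>j. g j + h j)" by (auto simp: distance_power_def g_def h_def)
  have g: "g sums (\<Sum>j<k. x ^ (k - j))"
    unfolding g_def using sums_If_finite_set[of "{..<k}" "\<lambda>j. x ^ (k - j)"] by simp
  have "(\<Sum>j<k. x ^ (k - j)) = (\<Sum>j<k. (\<lambda>i. x * x ^ i) (k - Suc j))"
    by (intro sum.cong refl) (metis Suc_diff_Suc lessThan_iff power_Suc)
  also have "\<dots> = x * (\<Sum>i<k. x ^ i)"
    by (subst sum.nat_diff_reindex) (simp add: sum_distrib_left)
  also have "(\<Sum>i<k. x ^ i) \<le> (\<Sum>i. x ^ i)"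
    using x by (intro sum_le_suminf summable_geometric) auto
  also have "(\<Sum>i. x ^ i) = 1 / (1 - x)" using x by (intro suminf_geometric) auto
  finally have g_le: "(\<Sum>j<k. x ^ (k - j)) \<le> x / (1 - x)" using x by (simp add: mult_left_mono)
  have "(\<lambda>i. x * x ^ i) sums (x * (1 / (1 - x)))"
    using x by (intro sums_mult geometric_sums) auto
  then have "(\<lambda>i. h (i + Suc k)) sums (x / (1 - x))" by (simp add: h_def)
  then have h: "h sums (x / (1 - x))"
    by (subst (asm) sums_iff_shift) (simp add: h_def)
  have "distance_power x k sums ((\<Sum>j<k. x ^ (k - j)) + x / (1 - x))"
    unfolding fgh by (rule sums_add[OF g h])
  then show "summable (distance_power x k)" "suminf (distance_power x k) \<le> 2 * x / (1 - x)"
    using g_le by (auto simp: sums_iff)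
qed

section \<open>Meromorphy of the series and exclusion of zeros\<close>

text \<open>Near \<open>w0\<close> the series splits into a finite sum of simple fractions and a
  tail whose poles are far away. The tail converges uniformly by the Weierstrass M-test, so it is
  holomorphic.\<close>

lemma not_essential_simple_fraction_series:
  assumes z: "filterlim z at_infinity sequentially"
    and summ: "summable (\<lambda>k. norm (a k / z k))"
  shows "not_essential (simple_fraction_series a z) w0"
proof -
  \<comment> \<open>\<open>R\<close> bounds the modulus on the unit ball around \<open>w0\<close>;
    poles of modulus at least \<open>2 * R\<close> then satisfy
    \<open>norm (w - z k) \<ge> norm (z k) / 2\<close> there.\<close>
  define R where "R = norm w0 + 1"
  have "eventually (\<lambda>k. 2 * R \<le> norm (z k)) sequentially"
    using z unfolding filterlim_at_infinity_conv_norm_at_top filterlim_at_top by blast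
  then obtain M where M: "\<And>k. k \<ge> M \<Longrightarrow> norm (z k) \<ge> 2 * R"
    unfolding eventually_sequentially by blast
  define g where "g w = (\<Sum>k. a (k + M) / (w - z (k + M)))" for w
  have R: "R > 0" unfolding R_def by (simp add: add_nonneg_pos)
  have far: "norm (w - z (k + M)) \<ge> norm (z (k + M)) / 2" if "w \<in> ball w0 1" for w k
  proof -
    have "norm w \<le> R"
      using that norm_triangle_ineq3[of w w0] unfolding R_def by (simp add: dist_norm norm_minus_commute)
    then show ?thesis
      using M[of "k + M"] norm_triangle_ineq2[of "z (k + M)" w] by (simp add: norm_minus_commute)
  qed
  have bound: "norm (a (k + M) / (w - z (k + M))) \<le> 2 * norm (a (k + M) / z (k + M))"
    if "w \<in> ball w0 1" for w k
  proof -
    have "norm (z (k + M)) > 0" using M[of "k + M"] R by linarith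
    then have "norm (a (k + M)) / norm (w - z (k + M)) \<le> norm (a (k + M)) / (norm (z (k + M)) / 2)"
      using far[OF that, of k] by (intro divide_left_mono) (auto intro!: mult_pos_pos order.strict_trans2[OF _ far[OF that, of k]])
    then show ?thesis by (simp add: norm_divide mult.commute)
  qed
  have summ': "summable (\<lambda>k. 2 * norm (a (k + M) / z (k + M)))"
    using summ by (intro summable_mult) (simp add: summable_iff_shift[where f = "\<lambda>k. norm (a k / z k)"])
  have lim: "uniform_limit (ball w0 1) (\<lambda>n w. \<Sum>k<n. a (k + M) / (w - z (k + M))) g sequentially"
    unfolding g_def by (rule Weierstrass_m_test[OF bound summ'])
  have "g holomorphic_on ball w0 1"
  proof (rule holomorphic_uniform_sequence)
    show "(\<lambda>w. \<Sum>k<n. a (k + M) / (w - z (k + M))) holomorphic_on ball w0 1" for n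
    proof (intro holomorphic_intros)
      fix k w assume "w \<in> ball w0 1"
      then show "w - z (k + M) \<noteq> 0" using far[of w k] M[of "k + M"] R by auto
    qed
    fix x assume x: "x \<in> ball w0 1"
    then obtain d where "d > 0" "cball x d \<subseteq> ball w0 1"
      using open_contains_cball_eq[OF open_ball] by blast
    then show "\<exists>d>0. cball x d \<subseteq> ball w0 1 \<and>
        uniform_limit (cball x d) (\<lambda>n w. \<Sum>k<n. a (k + M) / (w - z (k + M))) g sequentially"
      using uniform_limit_on_subset[OF lim] by blast
  qed auto
  then have "g analytic_on {w0}"
    by (meson analytic_at centre_in_ball open_ball zero_less_one)
  then have "(\<lambda>w. (\<Sum>k<M. a k / (w - z k)) + g w) meromorphic_on {w0}"
    by (intro meromorphic_intros analytic_on_imp_meromorphic_on)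
       (auto intro: analytic_intros)
  then have "not_essential (\<lambda>w. (\<Sum>k<M. a k / (w - z k)) + g w) w0"
    by (simp add: meromorphic_at_iff)
  moreover have "simple_fraction_series a z w = (\<Sum>k<M. a k / (w - z k)) + g w"
    if w: "w \<in> ball w0 1" for w
  proof -
    have "summable (\<lambda>k. a (k + M) / (w - z (k + M)))"
      by (rule summable_comparison_test'[OF summ' bound[OF w]])
    then have "summable (\<lambda>k. a k / (w - z k))"
      by (subst (asm) summable_iff_shift)
    then show ?thesis
      unfolding simple_fraction_series_def g_def by (subst suminf_split_initial_segment[of _ M]) auto
  qed
  then have "eventually (\<lambda>w. simple_fraction_series a z w = (\<Sum>k<M. a k / (w - z k)) + g w) (at w0)"
    by (intro eventually_at_in_open'[of "ball w0 1", THEN eventually_mono]) auto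
  ultimately show ?thesis by (simp cong: not_essential_cong)
qed

text \<open>At a non-pole \<open>remove_sings\<close> takes the limit value, and a lower bound on a
  punctured neighbourhood passes to the limit. Values of \<open>f\<close> at the point itself never
  enter.\<close>

lemma meromorphic_zeros_empty:
  assumes ne: "\<And>w. not_essential f w"
    and low: "\<And>w. \<exists>c>0. eventually (\<lambda>u. norm (f u) \<ge> c) (at w)"
  shows "meromorphic_zeros f = {}"
proof -
  have "remove_sings f w \<noteq> 0" if np: "\<not> is_pole f w" for w
  proof -
    obtain l where l: "f \<midarrow>w\<rightarrow> l" using ne[of w] np unfolding not_essential_def by blast
    obtain c where c: "c > 0" "eventually (\<lambda>u. norm (f u) \<ge> c) (at w)" using low by blast
    have "norm l \<ge> c"
      by (rule tendsto_lowerbound[OF tendsto_norm[OF l] c(2)]) simp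
    then show ?thesis using remove_sings_eqI[OF l] c(1) by auto
  qed
  then show ?thesis by (auto simp: meromorphic_zeros_def)
qed

section \<open>Logarithms of the factors close to 1\<close>

text \<open>For \<open>z\<^sub>k = 64\<^sup>k e\<^bsup>i\<theta>\<^sub>k\<^esup>\<close> this is the one of \<open>z\<^sub>j/z\<^sub>k\<close>, \<open>z\<^sub>k/z\<^sub>j\<close> with modulus less than 1,
  and 0 for \<open>j = k\<close>.\<close>
definition small_ratio :: "(nat \<Rightarrow> real) \<Rightarrow> nat \<Rightarrow> nat \<Rightarrow> complex" where
  "small_ratio \<theta> k j =
    of_real (distance_power (1/64) k j) * cis (if j < k then \<theta> j - \<theta> k else \<theta> k - \<theta> j)"

lemma norm_small_ratio: "norm (small_ratio \<theta> k j) = distance_power (1/64) k j"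
  by (simp add: small_ratio_def norm_mult distance_power_nonneg)

lemma norm_small_ratio_le_half: "norm (small_ratio \<theta> k j) \<le> 1/2"
  unfolding norm_small_ratio by (rule order_trans[OF distance_power_le]) auto

lemma norm_small_ratio_diff_le:
  "norm (small_ratio \<theta> k j - small_ratio \<phi> k j) \<le>
    distance_power (1/64) k j * (\<bar>\<theta> j - \<phi> j\<bar> + \<bar>\<theta> k - \<phi> k\<bar>)"
proof -
  let ?s = "\<lambda>\<theta>. if j < k then \<theta> j - \<theta> k else \<theta> k - \<theta> j :: real"
  have "small_ratio \<theta> k j - small_ratio \<phi> k j =
      of_real (distance_power (1/64) k j) * (cis (?s \<theta>) - cis (?s \<phi>))"
    by (simp add: small_ratio_def right_diff_distrib)
  also have "norm \<dots> = distance_power (1/64) k j * norm (cis (?s \<theta>) - cis (?s \<phi>))"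
    by (simp add: norm_mult distance_power_nonneg)
  also have "\<dots> \<le> distance_power (1/64) k j * (\<bar>\<theta> j - \<phi> j\<bar> + \<bar>\<theta> k - \<phi> k\<bar>)"
    by (intro mult_left_mono distance_power_nonneg order_trans[OF norm_cis_diff_le]) auto
  finally show ?thesis .
qed

text \<open>The imaginary part of the sum over \<open>j\<close> is the perturbation in the equations
  for the angles. The diagonal term is \<open>Ln 1 = 0\<close>.\<close>

definition log_factor :: "(nat \<Rightarrow> real) \<Rightarrow> nat \<Rightarrow> nat \<Rightarrow> complex" where
  "log_factor \<theta> k j = Ln (1 - small_ratio \<theta> k j)"

lemma exp_log_factor: "exp (log_factor \<theta> k j) = 1 - small_ratio \<theta> k j"
proof -
  have "small_ratio \<theta> k j \<noteq> 1" using norm_small_ratio_le_half[of \<theta> k j] by auto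
  then show ?thesis by (simp add: log_factor_def)
qed

lemma norm_log_factor_le: "norm (log_factor \<theta> k j) \<le> 2 * distance_power (1/64) k j"
  using norm_Ln_one_minus_diff_le[of "small_ratio \<theta> k j" 0] norm_small_ratio_le_half[of \<theta> k j]
  by (simp add: log_factor_def norm_small_ratio)

lemma summable_log_factor: "summable (log_factor \<theta> k)"
  by (rule summable_comparison_test'[OF summable_mult[OF distance_power_sum(1)] norm_log_factor_le])
     auto

text \<open>The geometric sums give 4/63; the bound 1/2 suffices below, where it keeps a cosine
  positive.\<close>

lemma norm_suminf_log_factor_le: "norm (suminf (log_factor \<theta> k)) \<le> 1/2"
proof -
  have s: "summable (\<lambda>j. 2 * distance_power (1/64) k j)"
    by (intro summable_mult distance_power_sum) auto
  have "norm (suminf (log_factor \<theta> k)) \<le> (\<Sum>j. 2 * distance_power (1/64) k j)"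
    by (rule norm_suminf_le[OF norm_log_factor_le s])
  also have "\<dots> = 2 * suminf (distance_power (1/64) k)"
    by (intro suminf_mult distance_power_sum) auto
  also have "\<dots> \<le> 1/2" using distance_power_sum(2)[of "1/64" k] by simp
  finally show ?thesis .
qed

text \<open>The weights \<open>2 ^ j\<close> and \<open>2 ^ k\<close> are at most
  \<open>2 ^ (k + d)\<close> with \<open>d\<close> the distance of \<open>j\<close> and
  \<open>k\<close>. The decay \<open>(1/64) ^ d\<close> absorbs \<open>2 ^ d\<close> and leaves
  \<open>(1/32) ^ d\<close>, whose sum over \<open>j \<noteq> k\<close> is at most 2/31.\<close>

lemma norm_suminf_log_factor_diff_le:
  assumes D: "\<And>j. \<bar>\<theta> j - \<phi> j\<bar> \<le> 2 ^ j * D"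
  shows "norm (suminf (log_factor \<theta> k) - suminf (log_factor \<phi> k)) \<le> 8/31 * 2 ^ k * D"
proof -
  have "0 \<le> D" using D[of 0] by simp
  have bound: "norm (log_factor \<theta> k j - log_factor \<phi> k j) \<le> 4 * 2 ^ k * D * distance_power (1/32) k j" for j
  proof -
    define d where "d = (k - j) + (j - k)"
    have "norm (log_factor \<theta> k j - log_factor \<phi> k j) \<le>
        2 * (distance_power (1/64) k j * (\<bar>\<theta> j - \<phi> j\<bar> + \<bar>\<theta> k - \<phi> k\<bar>))"
      unfolding log_factor_def
      by (rule order_trans[OF norm_Ln_one_minus_diff_le])
         (use norm_small_ratio_le_half norm_small_ratio_diff_le in auto)
    also have "\<dots> \<le> 2 * (distance_power (1/64) k j * (2 ^ j * D + 2 ^ k * D))"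
      by (intro mult_left_mono add_mono D distance_power_nonneg) auto
    also have "\<dots> \<le> 2 * (distance_power (1/64) k j * (2 ^ (k + d) * D + 2 ^ (k + d) * D))"
      using \<open>0 \<le> D\<close>
      by (intro mult_left_mono add_mono mult_right_mono power_increasing distance_power_nonneg)
         (auto simp: d_def)
    also have "\<dots> = 4 * 2 ^ k * D * (2 ^ d * distance_power (1/64) k j)"
      by (simp add: power_add)
    also have "2 ^ d * distance_power (1/64) k j = distance_power (1/32) k j"
      unfolding distance_power_def d_def[symmetric]
      by (auto simp flip: power_mult_distrib)
    finally show ?thesis .
  qed
  have s: "summable (\<lambda>j. 4 * 2 ^ k * D * distance_power (1/32) k j)"
    by (intro summable_mult distance_power_sum) auto
  have "norm (suminf (log_factor \<theta> k) - suminf (log_factor \<phi> k)) =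
      norm (\<Sum>j. log_factor \<theta> k j - log_factor \<phi> k j)"
    by (subst suminf_diff[OF summable_log_factor summable_log_factor]) simp
  also have "\<dots> \<le> (\<Sum>j. 4 * 2 ^ k * D * distance_power (1/32) k j)"
    by (rule norm_suminf_le[OF bound s])
  also have "\<dots> = 4 * 2 ^ k * D * suminf (distance_power (1/32) k)"
    by (intro suminf_mult distance_power_sum) auto
  also have "\<dots> \<le> 4 * 2 ^ k * D * (2/31)"
    using \<open>0 \<le> D\<close> distance_power_sum(2)[of "1/32" k] by (intro mult_left_mono) auto
  finally show ?thesis by simp
qed

section \<open>Contraction principle and choice of the angles\<close>

text \<open>Picard iteration from \<open>p\<close>, convergent in each coordinate. Quantifying over
  \<open>D\<close> in \<open>lipschitz\<close> stands in for a weighted supremum distance, which may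
  be infinite between arbitrary functions; \<open>start\<close> makes the first step finite.\<close>

lemma weighted_contraction_fixed_point:
  fixes T :: "('a \<Rightarrow> 'b :: banach) \<Rightarrow> 'a \<Rightarrow> 'b" and W :: "'a \<Rightarrow> real"
  assumes c: "0 \<le> c" "c < 1"
    and lipschitz: "\<And>x y D k. (\<And>j. norm (x j - y j) \<le> W j * D) \<Longrightarrow>
      norm (T x k - T y k) \<le> W k * (c * D)"
    and start: "\<And>k. norm (T p k - p k) \<le> W k * C"
  obtains x where "T x = x"
proof -
  define X where "X n = (T ^^ n) p" for n
  have X: "X 0 = p" "X (Suc n) = T (X n)" for n by (auto simp: X_def)
  have step: "norm (X (Suc n) k - X n k) \<le> W k * (c ^ n * C)" for n k
  proof (induction n arbitrary: k)
    case (Suc n)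
    have "norm (T (X (Suc n)) k - T (X n) k) \<le> W k * (c * (c ^ n * C))"
      by (rule lipschitz) (rule Suc)
    then show ?case by (simp add: X mult.assoc)
  qed (simp add: X start)
  have summ: "summable (\<lambda>n. W k * (c ^ n * C))" for k
    using c by (intro summable_mult summable_mult2 summable_geometric) auto
  have summ': "summable (\<lambda>n. X (Suc n) k - X n k)" for k
    by (rule summable_comparison_test'[OF summ step])
  define x where "x k = p k + (\<Sum>n. X (Suc n) k - X n k)" for k
  have lim: "(\<lambda>n. X n k) \<longlonglongrightarrow> x k" for k
  proof -
    have "(\<lambda>n. p k + (\<Sum>i<n. X (Suc i) k - X i k)) \<longlonglongrightarrow> x k"
      unfolding x_def by (intro tendsto_intros summable_LIMSEQ summ')
    then show ?thesis by (simp add: sum_lessThan_telescope[of "\<lambda>i. X i k"] X(1))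
  qed
  have dist: "norm (x k - X n k) \<le> W k * (c ^ n * (C / (1 - c)))" for n k
  proof -
    have tail: "(\<lambda>m. X (m + n) k - X n k) \<longlonglongrightarrow> x k - X n k"
      by (rule tendsto_diff[OF LIMSEQ_ignore_initial_segment[OF lim] tendsto_const])
    have "norm (X (m + n) k - X n k) \<le> W k * (c ^ n * (C / (1 - c)))" for m
    proof -
      \<comment> \<open>The sign of this product comes from \<open>start\<close>, where it bounds a
        norm.\<close>
      have WC: "0 \<le> W k * C" using start[of k] norm_ge_zero order_trans by blast
      have "0 \<le> W k * C * c ^ n" using WC c(1) by (rule mult_nonneg_nonneg[OF _ zero_le_power])
      have "X (m + n) k - X n k = (\<Sum>i<m. X (Suc (i + n)) k - X (i + n) k)"
        using sum_lessThan_telescope[of "\<lambda>i. X (i + n) k" m] by simp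
      also have "norm \<dots> \<le> (\<Sum>i<m. W k * (c ^ (i + n) * C))"
        by (rule sum_norm_le) (rule step)
      also have "\<dots> = (W k * C * c ^ n) * (\<Sum>i<m. c ^ i)"
        by (simp add: sum_distrib_left power_add mult_ac)
      also have "\<dots> \<le> (W k * C * c ^ n) * (\<Sum>i. c ^ i)"
        using c by (intro mult_left_mono sum_le_suminf summable_geometric \<open>0 \<le> W k * C * c ^ n\<close>) simp_all
      also have "(\<Sum>i. c ^ i) = 1 / (1 - c)" using c by (intro suminf_geometric) auto
      finally show ?thesis by (simp add: mult_ac)
    qed
    then show ?thesis
      by (intro tendsto_upperbound[OF tendsto_norm[OF tail]]) auto
  qed
  \<comment> \<open>Both sides are limits of the shifted iterates: \<open>lipschitz\<close> applied
    to \<open>dist\<close> gives one, \<open>lim\<close> the other.\<close>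
  have "T x k = x k" for k
  proof (rule LIMSEQ_unique)
    have "(\<lambda>n. W k * (c * (c ^ n * (C / (1 - c))))) \<longlonglongrightarrow> W k * (c * (0 * (C / (1 - c))))"
      using c by (intro tendsto_mult tendsto_const LIMSEQ_power_zero) simp
    then have "(\<lambda>n. W k * (c * (c ^ n * (C / (1 - c))))) \<longlonglongrightarrow> 0"
      by (simp only: mult_zero_left mult_zero_right)
    moreover have "norm (T x k - X (Suc n) k) \<le> W k * (c * (c ^ n * (C / (1 - c))))" for n
      unfolding X(2) by (rule lipschitz) (rule dist)
    ultimately have "(\<lambda>n. T x k - X (Suc n) k) \<longlonglongrightarrow> 0"
      by (rule Lim_null_comparison[OF always_eventually[OF allI], rotated])
    then have "(\<lambda>n. T x k - (T x k - X (Suc n) k)) \<longlonglongrightarrow> T x k - 0"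
      by (rule tendsto_diff[OF tendsto_const])
    then show "(\<lambda>n. X (Suc n) k) \<longlonglongrightarrow> T x k"
      by (simp only: diff_diff_eq2 add_diff_cancel_left' diff_zero)
    show "(\<lambda>n. X (Suc n) k) \<longlonglongrightarrow> x k" by (rule LIMSEQ_Suc[OF lim])
  qed
  then show ?thesis using that by blast
qed

text \<open>The equation says that the arguments of the factors
  \<open>1 - z\<^sub>k/z\<^sub>j\<close> with \<open>j \<noteq> k\<close> add up to 0: each
  \<open>j < k\<close> contributes \<open>\<theta> k + pi - \<theta> j\<close>, and the logarithms
  contribute the rest.\<close>

lemma phases_exist:
  obtains \<theta> :: "nat \<Rightarrow> real" where
    "\<And>k. k > 0 \<Longrightarrow> real k * (\<theta> k + pi) = (\<Sum>j<k. \<theta> j) - Im (suminf (log_factor \<theta> k))"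
proof -
  \<comment> \<open>Solving the equation for the explicit \<open>\<theta> k\<close> gives
    \<open>T\<close>. Only differences of angles matter in the equations, so
    \<open>\<theta> 0 = 0\<close> is a normalisation by rotation.\<close>
  define T where "T \<theta> k =
    (if k = 0 then 0 else ((\<Sum>j<k. \<theta> j) - Im (suminf (log_factor \<theta> k))) / real k - pi)"
    for \<theta> :: "nat \<Rightarrow> real" and k
  have pow: "(2 ^ k - 1) / real k \<le> 2 ^ k / 2" if "k > 0" for k
  proof (cases "k = 1")
    case False
    then have "real k \<ge> 2" using that by linarith
    then have "2 * 2 ^ k \<le> real k * 2 ^ k" by (intro mult_right_mono) auto
    then have "2 * 2 ^ k \<le> 2 + real k * 2 ^ k" by linarith
    then show ?thesis using that by (simp add: field_simps)
  qed simp
  \<comment> \<open>The average of \<open>\<theta>\<^sub>j\<close> over \<open>j < k\<close> does not contract in the plain supremum norm,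
    but with weights \<open>2\<^sup>k\<close> it does, with factor 1/2.\<close>
  obtain \<theta> where \<theta>: "T \<theta> = \<theta>"
  proof (rule weighted_contraction_fixed_point[where T = T and W = "\<lambda>k. 2 ^ k" and c = "4/5"
        and p = "\<lambda>_. 0" and C = "1 + pi"])
    fix x y :: "nat \<Rightarrow> real" and D k
    assume xy: "norm (x j - y j) \<le> 2 ^ j * D" for j
    then have D: "0 \<le> D" using xy[of 0] by (simp add: order_trans[OF norm_ge_zero])
    show "norm (T x k - T y k) \<le> 2 ^ k * (4/5 * D)"
    proof (cases "k = 0")
      case False
      define d where "d = (\<Sum>j<k. x j - y j)"
      define e where "e = Im (suminf (log_factor x k) - suminf (log_factor y k))"
      have "\<bar>d\<bar> \<le> (\<Sum>j<k. 2 ^ j * D)"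
        unfolding d_def using xy by (intro order_trans[OF sum_abs] sum_mono) auto
      also have "\<dots> = (2 ^ k - 1) * D"
        by (simp add: mask_eq_sum_exp flip: sum_distrib_right) (induction k; simp)
      finally have "\<bar>d\<bar> / real k \<le> ((2 ^ k - 1) / real k) * D" by (simp add: divide_right_mono)
      also have "\<dots> \<le> 2 ^ k / 2 * D" using False D by (intro mult_right_mono pow) auto
      finally have d: "\<bar>d\<bar> / real k \<le> 2 ^ k / 2 * D" .
      have "\<bar>e\<bar> / real k \<le> \<bar>e\<bar>" using False by (simp add: divide_le_eq mult_le_cancel_left1)
      also have "\<dots> \<le> 8/31 * 2 ^ k * D"
        unfolding e_def using xy
        by (intro order_trans[OF abs_Im_le_cmod] norm_suminf_log_factor_diff_le) auto
      finally have e: "\<bar>e\<bar> / real k \<le> 8/31 * 2 ^ k * D" .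
      have "T x k - T y k = d / real k - e / real k"
        using False by (simp add: T_def d_def e_def sum_subtractf diff_divide_distrib)
      then have "norm (T x k - T y k) \<le> \<bar>d\<bar> / real k + \<bar>e\<bar> / real k"
        using abs_triangle_ineq4[of "d / real k" "e / real k"] by (simp add: abs_divide)
      also have "\<dots> \<le> 2 ^ k / 2 * D + 8/31 * 2 ^ k * D" by (intro add_mono d e)
      \<comment> \<open>The average contributes 1/2 and the logarithms 8/31; the sum 47/62 is below
        4/5.\<close>
      also have "\<dots> = 2 ^ k * ((1/2 + 8/31) * D)" by (simp add: algebra_simps)
      also have "\<dots> \<le> 2 ^ k * (4/5 * D)" using D by (intro mult_left_mono mult_right_mono) auto
      finally show ?thesis .
    qed (simp add: T_def D)
  next
    fix k
    define I where "I = Im (suminf (log_factor (\<lambda>_. 0) k))"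
    have I: "\<bar>I\<bar> \<le> 1"
      using abs_Im_le_cmod[of "suminf (log_factor (\<lambda>_. 0) k)"] norm_suminf_log_factor_le[of "\<lambda>_. 0" k]
      unfolding I_def by linarith
    have "\<bar>T (\<lambda>_. 0) k\<bar> \<le> 1 * (1 + pi)"
    proof (cases "k = 0")
      case False
      then have "\<bar>I / real k\<bar> \<le> \<bar>I\<bar>" by (simp add: abs_divide divide_le_eq mult_le_cancel_left1)
      then have "\<bar>- I / real k - pi\<bar> \<le> 1 + pi"
        using I abs_triangle_ineq4[of "- I / real k" pi] by simp
      then show ?thesis using False by (simp add: T_def I_def)
    qed (use pi_gt_zero in \<open>simp add: T_def\<close>)
    also have "1 * (1 + pi) \<le> 2 ^ k * (1 + pi)"
      using pi_gt_zero by (intro mult_right_mono) auto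
    finally show "norm (T (\<lambda>_. 0) k - 0) \<le> 2 ^ k * (1 + pi)" by simp
  qed auto
  have "real k * (\<theta> k + pi) = (\<Sum>j<k. \<theta> j) - Im (suminf (log_factor \<theta> k))" if "k > 0" for k
  proof -
    have "\<theta> k + pi = ((\<Sum>j<k. \<theta> j) - Im (suminf (log_factor \<theta> k))) / real k"
      using fun_cong[OF \<theta>, of k] that by (simp add: T_def)
    then show ?thesis using that by simp
  qed
  then show ?thesis using that by blast
qed

section \<open>Poles of geometric growth and the weights\<close>

definition spiral_pole :: "(nat \<Rightarrow> real) \<Rightarrow> nat \<Rightarrow> complex" where
  "spiral_pole \<theta> k = of_real (64 ^ k) * cis (\<theta> k)"

lemma norm_spiral_pole: "norm (spiral_pole \<theta> k) = 64 ^ k"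
  by (simp add: spiral_pole_def norm_mult norm_power)

lemma spiral_pole_nonzero: "spiral_pole \<theta> k \<noteq> 0"
  by (simp add: spiral_pole_def)

lemma inj_spiral_pole: "inj_on (spiral_pole \<theta>) A"
proof (rule inj_onI)
  fix i j assume "spiral_pole \<theta> i = spiral_pole \<theta> j"
  then have "(64::real) ^ i = 64 ^ j" by (metis norm_spiral_pole)
  then show "i = j" by simp
qed

lemma filterlim_spiral_pole: "filterlim (spiral_pole \<theta>) at_infinity sequentially"
  using filterlim_realpow_sequentially_gt1[of "64 :: real"]
  by (simp add: filterlim_at_infinity_conv_norm_at_top norm_spiral_pole norm_power)

text \<open>The leading part of \<open>1 - z\<^sub>k/z\<^sub>j\<close>, whose argument is linear in
  the angles modulo full turns. What remains is \<open>1 - small_ratio \<theta> k j\<close>, since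
  \<open>1 - q = - q * (1 - 1/q)\<close> for \<open>j < k\<close>.\<close>

definition dominant_factor :: "(nat \<Rightarrow> real) \<Rightarrow> nat \<Rightarrow> nat \<Rightarrow> complex" where
  "dominant_factor \<theta> k j = (if j < k then - (spiral_pole \<theta> k / spiral_pole \<theta> j) else 1)"

lemma spiral_pole_divide:
  "spiral_pole \<theta> k / spiral_pole \<theta> j = of_real (64 ^ k / 64 ^ j) * cis (\<theta> k - \<theta> j)"
  unfolding spiral_pole_def of_real_divide cis_divide[symmetric]
  by (rule times_divide_times_eq[symmetric])

lemma one_minus_spiral_pole_divide:
  assumes "j \<noteq> k"
  shows "1 - spiral_pole \<theta> k / spiral_pole \<theta> j = dominant_factor \<theta> k j * (1 - small_ratio \<theta> k j)"
proof (cases "j < k")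
  case True
  then have "small_ratio \<theta> k j = spiral_pole \<theta> j / spiral_pole \<theta> k"
    unfolding spiral_pole_divide
    by (simp add: small_ratio_def distance_power_def power_diff power_divide)
  then show ?thesis using True spiral_pole_nonzero
    by (simp add: dominant_factor_def field_simps)
next
  case False
  then have "small_ratio \<theta> k j = spiral_pole \<theta> k / spiral_pole \<theta> j"
    using assms unfolding spiral_pole_divide
    by (simp add: small_ratio_def distance_power_def power_diff power_divide)
  then show ?thesis using False by (simp add: dominant_factor_def)
qed

text \<open>The factor at \<open>j = k\<close> on the right is \<open>1 * (1 - 0)\<close>, so the
  index \<open>k\<close> can be put back.\<close>

lemma prod_one_minus_spiral_pole_divide:
  "(\<Prod>j\<in>{..<N} - {k}. 1 - spiral_pole \<theta> k / spiral_pole \<theta> j) =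
    (\<Prod>j<N. dominant_factor \<theta> k j * (1 - small_ratio \<theta> k j))"
  by (rule prod.mono_neutral_cong_left)
     (auto simp: one_minus_spiral_pole_divide dominant_factor_def small_ratio_def distance_power_def)

lemma prod_dominant_factor:
  assumes "k \<le> N"
  shows "(\<Prod>j<N. dominant_factor \<theta> k j) = (\<Prod>j<k. dominant_factor \<theta> k j)"
  by (rule prod.mono_neutral_right) (use assms in \<open>auto simp: dominant_factor_def\<close>)

text \<open>This is \<open>1/b\<^sub>k\<close>, the infinite product of
  \<open>1 - z\<^sub>k/z\<^sub>j\<close> over \<open>j \<noteq> k\<close>, in a form from which its
  argument can be read off.\<close>

definition inverse_weight :: "(nat \<Rightarrow> real) \<Rightarrow> nat \<Rightarrow> complex" where
  "inverse_weight \<theta> k = (\<Prod>j<k. dominant_factor \<theta> k j) * exp (suminf (log_factor \<theta> k))"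

lemma inverse_weight_limit:
  "(\<lambda>N. \<Prod>j\<in>{..<N} - {k}. 1 - spiral_pole \<theta> k / spiral_pole \<theta> j) \<longlonglongrightarrow> inverse_weight \<theta> k"
proof -
  have "(\<lambda>N. (\<Prod>j<k. dominant_factor \<theta> k j) * exp (\<Sum>j<N. log_factor \<theta> k j)) \<longlonglongrightarrow> inverse_weight \<theta> k"
    unfolding inverse_weight_def
    by (intro tendsto_intros summable_LIMSEQ summable_log_factor)
  moreover have "eventually (\<lambda>N. (\<Prod>j<k. dominant_factor \<theta> k j) * exp (\<Sum>j<N. log_factor \<theta> k j) =
      (\<Prod>j\<in>{..<N} - {k}. 1 - spiral_pole \<theta> k / spiral_pole \<theta> j)) sequentially"
    using eventually_ge_at_top[of k]
  proof eventually_elim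
    case (elim N)
    then show ?case
      by (simp add: prod_one_minus_spiral_pole_divide prod.distrib prod_dominant_factor[OF elim]
          exp_sum exp_log_factor)
  qed
  ultimately show ?thesis by (rule Lim_transform_eventually)
qed

text \<open>Each of the \<open>k\<close> nontrivial dominant factors has modulus at least 64, and
  the remaining factors together at least 1/2 by the Weierstrass product inequality. Uniformity in
  \<open>N\<close> provides the majorant for the limit of the partial fractions.\<close>

lemma norm_prod_ge:
  assumes "k < N"
  shows "norm (\<Prod>j\<in>{..<N} - {k}. 1 - spiral_pole \<theta> k / spiral_pole \<theta> j) \<ge> 64 ^ k / 2"
proof -
  have "64 ^ k = (\<Prod>j<k. 64 :: real)" by simp
  also have "\<dots> \<le> (\<Prod>j<k. norm (dominant_factor \<theta> k j))"
  proof (rule prod_mono)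
    fix j assume "j \<in> {..<k}"
    then have "j < k" by simp
    then have "(64::real) ^ 1 \<le> 64 ^ (k - j)" by (intro power_increasing) auto
    then show "0 \<le> (64::real) \<and> 64 \<le> norm (dominant_factor \<theta> k j)"
      using \<open>j < k\<close> by (simp add: dominant_factor_def norm_divide norm_spiral_pole power_diff)
  qed
  finally have 1: "64 ^ k \<le> norm (\<Prod>j<N. dominant_factor \<theta> k j)"
    using assms by (simp add: prod_dominant_factor[of k N] prod_norm)
  have "(\<Sum>j<N. distance_power (1/64) k j) \<le> suminf (distance_power (1/64) k)"
    by (intro sum_le_suminf distance_power_sum distance_power_nonneg) auto
  then have "1/2 \<le> 1 - (\<Sum>j<N. distance_power (1/64) k j)"
    using distance_power_sum(2)[of "1/64" k] by simp
  also have "\<dots> \<le> (\<Prod>j<N. 1 - distance_power (1/64) k j)"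
  proof (rule Weierstrass_prod_ineq)
    show "distance_power (1/64) k j \<in> {0..1}" for j
      using distance_power_nonneg[of "1/64" k j] distance_power_le[of "1/64" k j] by simp
  qed
  also have "\<dots> \<le> (\<Prod>j<N. norm (1 - small_ratio \<theta> k j))"
  proof (rule prod_mono)
    fix j
    have "distance_power (1/64) k j \<le> 1/64" by (rule distance_power_le) auto
    then show "0 \<le> 1 - distance_power (1/64) k j \<and>
        1 - distance_power (1/64) k j \<le> norm (1 - small_ratio \<theta> k j)"
      using norm_triangle_ineq2[of 1 "small_ratio \<theta> k j"] by (simp add: norm_small_ratio)
  qed
  finally have 2: "1/2 \<le> norm (\<Prod>j<N. 1 - small_ratio \<theta> k j)" by (simp add: prod_norm)
  show ?thesis
    using mult_mono[OF 1 2] by (simp add: prod_one_minus_spiral_pole_divide prod.distrib norm_mult)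
qed

lemma norm_inverse_weight_ge: "norm (inverse_weight \<theta> k) \<ge> 64 ^ k / 2"
  by (rule tendsto_lowerbound[OF tendsto_norm[OF inverse_weight_limit]
        eventually_mono[OF eventually_gt_at_top[of k] norm_prod_ge]]) simp_all

lemma inverse_weight_nonzero: "inverse_weight \<theta> k \<noteq> 0"
  using norm_inverse_weight_ge[of k \<theta>] by (smt (verit) norm_zero zero_less_power divide_pos_pos)

lemma norm_inverse_le:
  assumes "norm (x :: complex) \<ge> 64 ^ k / 2"
  shows "norm (inverse x) \<le> 2 * (1/64) ^ k"
proof -
  have "inverse (norm x) \<le> inverse (64 ^ k / 2)"
    using assms by (intro le_imp_inverse_le) auto
  also have "\<dots> = 2 * (1/64) ^ k" by (simp add: power_divide)
  finally show ?thesis by (simp add: norm_inverse)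
qed

section \<open>Passage to the limit in the partial fractions\<close>

text \<open>Tannery's theorem, applied to the finite partial fraction expansions with their terms
  extended by 0: the \<open>k\<close>-th term converges and is dominated by a constant times
  \<open>(1/64) ^ k\<close>, uniformly in \<open>N\<close>.\<close>

lemma inverse_prod_limit:
  assumes w: "w \<notin> range (spiral_pole \<theta>)"
  shows "(\<lambda>N. inverse (\<Prod>j<N. 1 - w / spiral_pole \<theta> j)) \<longlonglongrightarrow>
    (\<Sum>k. inverse (inverse_weight \<theta> k) / (1 - w / spiral_pole \<theta> k))"
    and "summable (\<lambda>k. inverse (inverse_weight \<theta> k) / (1 - w / spiral_pole \<theta> k))"
proof -
  let ?z = "spiral_pole \<theta>"
  let ?P = "\<lambda>N k. \<Prod>j\<in>{..<N} - {k}. 1 - ?z k / ?z j"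
  define A where "A k N = (if k < N then inverse (?P N k) / (1 - w / ?z k) else 0)" for k N
  \<comment> \<open>Convergence as the poles tend to infinity yields the bound \<open>C\<close>,
    valid for all \<open>k\<close>.\<close>
  have "(\<lambda>k. inverse (1 - w / ?z k)) \<longlonglongrightarrow> inverse (1 - 0)"
    by (intro tendsto_intros tendsto_divide_0[OF tendsto_const] filterlim_spiral_pole) auto
  then have "Bseq (\<lambda>k. inverse (1 - w / ?z k))"
    by (intro convergent_imp_Bseq convergentI)
  then obtain C where C: "\<And>k. norm (inverse (1 - w / ?z k)) \<le> C"
    unfolding Bseq_def by blast
  have lim: "A k \<longlonglongrightarrow> inverse (inverse_weight \<theta> k) / (1 - w / ?z k)" for k
  proof -
    have "1 - w / ?z k \<noteq> 0" using w spiral_pole_nonzero[of \<theta> k] by auto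
    then have "(\<lambda>N. inverse (?P N k) / (1 - w / ?z k)) \<longlonglongrightarrow>
        inverse (inverse_weight \<theta> k) / (1 - w / ?z k)"
      by (intro tendsto_intros inverse_weight_limit inverse_weight_nonzero)
    then show ?thesis
      by (rule Lim_transform_eventually)
         (rule eventually_mono[OF eventually_gt_at_top[of k]], simp add: A_def)
  qed
  have bound: "norm (A k N) \<le> 2 * (1/64) ^ k * C" for k N
  proof (cases "k < N")
    case True
    then have "norm (A k N) = norm (inverse (?P N k)) * norm (inverse (1 - w / ?z k))"
      by (simp add: A_def divide_inverse norm_mult)
    also have "\<dots> \<le> 2 * (1/64) ^ k * C"
      using norm_inverse_le[OF norm_prod_ge[OF True]] C by (intro mult_mono) auto
    finally show ?thesis .
  next
    case False
    have "0 \<le> C" using C[of 0] norm_ge_zero order_trans by blast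
    then show ?thesis using False by (simp add: A_def)
  qed
  have summ: "summable (\<lambda>k. 2 * (1/64) ^ k * C)"
    by (intro summable_mult2 summable_mult summable_geometric) auto
  have "eventually (\<lambda>(k, N). norm (A k N) \<le> 2 * (1/64) ^ k * C) (sequentially \<times>\<^sub>F sequentially)"
    by (rule always_eventually) (use bound in auto)
  note tannery = tannerys_theorem[where a = A, OF lim this summ sequentially_bot]
  then have lim_sum: "(\<lambda>N. suminf (\<lambda>k. A k N)) \<longlonglongrightarrow>
      (\<Sum>k. inverse (inverse_weight \<theta> k) / (1 - w / ?z k))"
    by (elim conjE)
  from tannery have "summable (\<lambda>k. norm (inverse (inverse_weight \<theta> k) / (1 - w / ?z k)))"
    by (elim conjE)
  then show "summable (\<lambda>k. inverse (inverse_weight \<theta> k) / (1 - w / ?z k))"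
    by (rule summable_norm_cancel)
  \<comment> \<open>The case \<open>N = 0\<close> must be left out: the empty product is 1, the
    empty sum 0.\<close>
  have "eventually (\<lambda>N. suminf (\<lambda>k. A k N) = inverse (\<Prod>j<N. 1 - w / ?z j)) sequentially"
    using eventually_gt_at_top[of 0]
  proof eventually_elim
    case (elim N)
    have "suminf (\<lambda>k. A k N) = (\<Sum>k<N. A k N)"
      by (rule suminf_finite) (simp_all only: A_def finite_lessThan lessThan_iff if_False not_False_eq_True)
    also have "\<dots> = (\<Sum>k<N. inverse (?P N k) / (1 - w / ?z k))"
      by (intro sum.cong refl) (simp only: A_def lessThan_iff if_True)
    also have "\<dots> = inverse (\<Prod>j<N. 1 - w / ?z j)"
      using elim w
      by (intro partial_fractions_inverse_prod[symmetric] inj_spiral_pole spiral_pole_nonzero) blast+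
    finally show ?case .
  qed
  with lim_sum show "(\<lambda>N. inverse (\<Prod>j<N. 1 - w / ?z j)) \<longlonglongrightarrow>
      (\<Sum>k. inverse (inverse_weight \<theta> k) / (1 - w / ?z k))"
    by (rule Lim_transform_eventually)
qed

text \<open>Every finite product has modulus at most \<open>exp (2 * norm w)\<close>, because
  \<open>1 + t \<le> exp t\<close> and the powers of 1/64 sum to at most 2. The bound on the
  reciprocals survives the limit and rules out zeros.\<close>

lemma norm_partial_fractions_ge:
  assumes w: "w \<notin> range (spiral_pole \<theta>)"
  shows "norm (\<Sum>k. inverse (inverse_weight \<theta> k) / (1 - w / spiral_pole \<theta> k)) \<ge> exp (- 2 * norm w)"
proof (rule tendsto_lowerbound[OF tendsto_norm[OF inverse_prod_limit(1)[OF w]]])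
  let ?z = "spiral_pole \<theta>"
  have "exp (- 2 * norm w) \<le> norm (inverse (\<Prod>j<N. 1 - w / ?z j))" for N
  proof -
    have "norm (\<Prod>j<N. 1 - w / ?z j) = (\<Prod>j<N. norm (1 - w / ?z j))" by (simp add: prod_norm)
    also have "\<dots> \<le> (\<Prod>j<N. exp (norm w * (1/64) ^ j))"
    proof (rule prod_mono, safe)
      fix j
      have "norm (1 - w / ?z j) \<le> 1 + norm w * (1/64) ^ j"
        using norm_triangle_ineq4[of 1 "w / ?z j"]
        by (simp add: norm_divide norm_spiral_pole power_divide)
      also have "\<dots> \<le> exp (norm w * (1/64) ^ j)" by (rule exp_ge_add_one_self)
      finally show "norm (1 - w / ?z j) \<le> exp (norm w * (1/64) ^ j)" .
    qed auto
    also have "\<dots> = exp (norm w * (\<Sum>j<N. (1/64) ^ j))"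
      by (simp add: exp_sum sum_distrib_left)
    also have "\<dots> \<le> exp (norm w * 2)"
    proof -
      have "(\<Sum>j<N. (1/64::real) ^ j) \<le> (\<Sum>j. (1/64) ^ j)"
        by (intro sum_le_suminf summable_geometric) auto
      also have "\<dots> \<le> 2" by (subst suminf_geometric) auto
      finally show ?thesis by (simp add: mult_left_mono)
    qed
    finally have "norm (\<Prod>j<N. 1 - w / ?z j) \<le> exp (norm w * 2)" .
    moreover have "(\<Prod>j<N. 1 - w / ?z j) \<noteq> 0" using w spiral_pole_nonzero by auto
    ultimately have "inverse (exp (norm w * 2)) \<le> inverse (norm (\<Prod>j<N. 1 - w / ?z j))"
      by (intro le_imp_inverse_le) auto
    then show ?thesis by (simp add: exp_minus norm_inverse mult.commute)
  qed
  then show "eventually (\<lambda>N. exp (- 2 * norm w) \<le> norm (inverse (\<Prod>j<N. 1 - w / ?z j))) sequentially"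
    by simp
qed simp

section \<open>Positivity of the weights\<close>

lemma prod_cis: "(\<Prod>j\<in>A. cis (f j)) = cis (\<Sum>j\<in>A. f j)"
  by (induction A rule: infinite_finite_induct) (auto simp: cis_mult)

text \<open>For \<open>k > 0\<close> the equation for the angles cancels the argument. For
  \<open>k = 0\<close> there is no equation; that weight is real because the
  \<open>b\<^sub>k\<close> sum to 1, and its sign comes from the bound on the logarithms.\<close>

lemma inverse_weight_pos:
  assumes \<theta>: "\<And>k. k > 0 \<Longrightarrow>
      real k * (\<theta> k + pi) = (\<Sum>j<k. \<theta> j) - Im (suminf (log_factor \<theta> k))"
  shows "\<exists>r>0. inverse_weight \<theta> k = of_real r"
proof -
  have pos: "\<exists>r>0. inverse_weight \<theta> k = of_real r" if k: "k > 0" for k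
  proof -
    let ?L = "suminf (log_factor \<theta> k)"
    have "dominant_factor \<theta> k j = of_real (64 ^ k / 64 ^ j) * cis (\<theta> k + pi - \<theta> j)" if "j < k" for j
    proof -
      have "cis (\<theta> k + pi - \<theta> j) = - cis (\<theta> k - \<theta> j)"
        using cis_mult[of "\<theta> k - \<theta> j" pi] by (simp add: algebra_simps)
      then show ?thesis using that by (simp add: dominant_factor_def spiral_pole_divide)
    qed
    then have "(\<Prod>j<k. dominant_factor \<theta> k j) =
        (\<Prod>j<k. of_real (64 ^ k / 64 ^ j) * cis (\<theta> k + pi - \<theta> j))"
      by (intro prod.cong) auto
    also have "\<dots> = of_real (\<Prod>j<k. 64 ^ k / 64 ^ j) * cis (\<Sum>j<k. \<theta> k + pi - \<theta> j)"
      unfolding prod.distrib prod_cis of_real_prod ..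
    also have "(\<Sum>j<k. \<theta> k + pi - \<theta> j) = - Im ?L"
      using \<theta>[OF k] by (simp add: sum_subtractf)
    finally have "inverse_weight \<theta> k =
        of_real (\<Prod>j<k. 64 ^ k / 64 ^ j) * cis (- Im ?L) * (of_real (exp (Re ?L)) * cis (Im ?L))"
      unfolding inverse_weight_def by (simp add: exp_eq_polar)
    also have "\<dots> = of_real ((\<Prod>j<k. 64 ^ k / 64 ^ j) * exp (Re ?L)) * (cis (- Im ?L) * cis (Im ?L))"
      by simp
    also have "cis (- Im ?L) * cis (Im ?L) = 1" by (simp add: cis_mult)
    finally have "inverse_weight \<theta> k = of_real ((\<Prod>j<k. 64 ^ k / 64 ^ j) * exp (Re ?L))"
      by (simp only: mult_1_right)
    moreover have "(\<Prod>j<k. 64 ^ k / 64 ^ j :: real) * exp (Re ?L) > 0"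
      by (intro mult_pos_pos prod_pos) auto
    ultimately show ?thesis by blast
  qed
  have "\<exists>r>0. inverse_weight \<theta> 0 = of_real r"
  proof -
    let ?L = "suminf (log_factor \<theta> 0)"
    let ?b = "\<lambda>k. inverse (inverse_weight \<theta> k)"
    \<comment> \<open>At \<open>w = 0\<close> all finite products equal 1, so the expansion reads
      \<open>suminf ?b = 1\<close>.\<close>
    have "0 \<notin> range (spiral_pole \<theta>)" using spiral_pole_nonzero[of \<theta>] by (auto dest: sym)
    from inverse_prod_limit[OF this] have "(\<lambda>N. 1) \<longlonglongrightarrow> suminf ?b" and s: "summable ?b" by simp_all
    then have "suminf ?b = 1" by (simp add: LIMSEQ_const_iff)
    then have "(\<Sum>k. Im (?b k)) = 0" using Im_suminf[OF s] by simp
    moreover have "(\<Sum>k. Im (?b k)) = (\<Sum>k\<in>{0}. Im (?b k))"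
    proof (rule suminf_finite)
      fix k :: nat assume "k \<notin> {0}"
      then obtain r where "inverse_weight \<theta> k = of_real r" using pos[of k] by auto
      then show "Im (?b k) = 0" by (simp flip: of_real_inverse)
    qed simp
    ultimately have im: "Im (?b 0) = 0" by simp
    \<comment> \<open>With an empty dominant product the weight is \<open>exp ?L\<close>, and an
      argument this small gives a positive real part.\<close>
    have "\<bar>Im ?L\<bar> \<le> 1/2"
      using abs_Im_le_cmod[of ?L] norm_suminf_log_factor_le[of \<theta> 0] by linarith
    then have "cos (Im ?L) > 0" using pi_gt3 by (intro cos_gt_zero_pi) linarith+
    then have re: "Re (inverse_weight \<theta> 0) > 0" by (simp add: inverse_weight_def Re_exp)
    have "Im (inverse_weight \<theta> 0) = 0"
      using im inverse_weight_nonzero[of \<theta> 0] by (auto simp: complex_eq_iff)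
    then show ?thesis using re by (intro exI[of _ "Re (inverse_weight \<theta> 0)"]) (simp add: complex_eq_iff)
  qed
  then show ?thesis using pos[of k] by (cases "k = 0") auto
qed

section \<open>The counterexample\<close>

theorem mainTheorem3:
  shows "\<not> (\<forall>(z :: nat \<Rightarrow> complex) (a :: nat \<Rightarrow> complex).
            filterlim z at_infinity sequentially \<longrightarrow>
            (\<lambda>k. norm (a k / z k)) summable_on {k. z k \<noteq> 0} \<longrightarrow>
            (\<forall>k. a k * cnj (z k) \<in> \<real> \<and> Re (a k * cnj (z k)) > 0) \<longrightarrow>
            infinite (meromorphic_zeros (simple_fraction_series a z)))"
proof -
  obtain \<theta> :: "nat \<Rightarrow> real" where \<theta>: "\<And>k. k > 0 \<Longrightarrow>
      real k * (\<theta> k + pi) = (\<Sum>j<k. \<theta> j) - Im (suminf (log_factor \<theta> k))"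
    using phases_exist by blast
  let ?z = "spiral_pole \<theta>"
  define b where "b k = inverse (inverse_weight \<theta> k)" for k
  \<comment> \<open>This makes \<open>a k / ?z k\<close> equal to \<open>b k\<close>, and
    \<open>a k * cnj (?z k)\<close> equal to \<open>b k\<close> times a positive square.\<close>
  define a where "a k = b k * ?z k" for k
  have summ: "summable (\<lambda>k. norm (a k / ?z k))"
  proof (rule summable_comparison_test')
    show "summable (\<lambda>k. 2 * (1/64::real) ^ k)" by (intro summable_mult summable_geometric) auto
    show "norm (norm (a k / ?z k)) \<le> 2 * (1/64) ^ k" for k
      using norm_inverse_le[OF norm_inverse_weight_ge[of k \<theta>]] spiral_pole_nonzero[of \<theta> k]
      by (simp add: a_def b_def)
  qed
  then have summ_on: "(\<lambda>k. norm (a k / ?z k)) summable_on {k. ?z k \<noteq> 0}"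
    by (simp add: spiral_pole_nonzero norm_summable_imp_summable_on)
  have pos: "a k * cnj (?z k) \<in> \<real> \<and> Re (a k * cnj (?z k)) > 0" for k
  proof -
    obtain r where r: "r > 0" "inverse_weight \<theta> k = of_real r"
      using inverse_weight_pos[OF \<theta>] by blast
    have "a k * cnj (?z k) = of_real (inverse r * (norm (?z k))\<^sup>2)"
      unfolding a_def b_def r(2) of_real_mult complex_norm_square by simp
    then show ?thesis using r(1) spiral_pole_nonzero[of \<theta> k] by simp
  qed
  have low: "exp (- 2 * norm w) \<le> norm (simple_fraction_series a ?z w)" if "w \<notin> range ?z" for w
  proof -
    have "a k / (w - ?z k) = - (b k / (1 - w / ?z k))" for k
    proof -
      have "w \<noteq> ?z k" using that by auto
      then show ?thesis using spiral_pole_nonzero[of \<theta> k] by (simp add: a_def divide_simps algebra_simps)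
    qed
    then have "simple_fraction_series a ?z w = - (\<Sum>k. b k / (1 - w / ?z k))"
      using inverse_prod_limit(2)[OF that] by (simp add: simple_fraction_series_def suminf_minus b_def)
    then show ?thesis using norm_partial_fractions_ge[OF that] by (simp add: b_def)
  qed
  have "meromorphic_zeros (simple_fraction_series a ?z) = {}"
  proof (rule meromorphic_zeros_empty)
    show "not_essential (simple_fraction_series a ?z) w" for w
      by (rule not_essential_simple_fraction_series[OF filterlim_spiral_pole summ])
    fix w :: complex
    have "eventually (\<lambda>k. norm w + 1 \<le> norm (?z k)) sequentially"
      using filterlim_spiral_pole[of \<theta>]
      unfolding filterlim_at_infinity_conv_norm_at_top filterlim_at_top by blast
    then obtain m where m: "\<And>k. k \<ge> m \<Longrightarrow> norm w + 1 \<le> norm (?z k)"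
      unfolding eventually_sequentially by blast
    \<comment> \<open>Poles with index at least \<open>m\<close> lie outside the ball. The point
      \<open>w\<close> stays in \<open>?V\<close> even if it is a pole, and is removed only by
      puncturing the neighbourhood.\<close>
    let ?V = "ball w 1 - (?z ` {..<m} - {w})"
    have "open ?V" by (intro open_Diff open_ball finite_imp_closed) auto
    then have "eventually (\<lambda>u. u \<in> ?V - {w}) (at w)" by (intro eventually_at_in_open) auto
    then have "eventually (\<lambda>u. exp (- 2 * (norm w + 1)) \<le> norm (simple_fraction_series a ?z u)) (at w)"
    proof eventually_elim
      case (elim u)
      have u: "norm u < norm w + 1"
        using elim norm_triangle_ineq2[of u w] by (simp add: dist_norm norm_minus_commute)
      have "u \<noteq> ?z k" for k
        using elim u m[of k] by (cases "k < m") auto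
      then have "exp (- 2 * norm u) \<le> norm (simple_fraction_series a ?z u)" by (intro low) auto
      moreover have "exp (- 2 * (norm w + 1)) \<le> exp (- 2 * norm u)" using u by simp
      ultimately show ?case by linarith
    qed
    then show "\<exists>c>0. eventually (\<lambda>u. norm (simple_fraction_series a ?z u) \<ge> c) (at w)"
      using exp_gt_zero by blast
  qed
  then show ?thesis using filterlim_spiral_pole summ_on pos by fastforce
qed

end
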